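(* Let $\sigma\in(-d,1)$. For every $r>0$, the functional $\hat J^\sigma_r:L^1(\mathbb{R}^d;[0,1])\to(-\infty,+\infty]$ is continuous with respect to the strong $L^1$ convergence. As a consequence, the monotone limit $\hat J^\sigma$ (as $r\to0^+$) is lower semicontinuous; more precisely, $\hat J^\sigma$ is the $\Gamma$-limit of $\{\hat J^\sigma_r\}_{r>0}$ with respect to the strong $L^1$ topology, as $r\to0^+$. The same $\Gamma$-convergence result holds true for the functionals $\hat J^\sigma_r$, $\hat J^\sigma$ defined on $\mathcal{M}_{\mathrm f}(\mathbb{R}^d)$ (i.e. restricted to characteristic functions of sets of finite measure).
   Context: Let $d\ge1$, let $|E|$ denote Lebesgue measure in $\mathbb{R}^d$, $\omega_d$ the measure of the unit ball, $B_r(x)$ the ball of radius $r$ and center $x$. $\mathcal{M}_{\mathrm f}(\mathbb{R}^d)$ is the family of measurable sets $E\subset\mathbb{R}^d$ with $|E|<+\infty$; $L^1(\mathbb{R}^d;[0,1])$ is the set of $L^1$ functions with values in $[0,1]$. For $\sigma\in(-d,1)$ and $r>0$ set $\gamma^\sigma_r:=d\omega_d\frac{1-r^{-\sigma}}{\sigma}$ if $\sigma\ne0$ and $\gamma^0_r:=d\omega_d\log r$. For $\rho\in L^1(\mathbb{R}^d;[0,1])$ set $$\hat J^\sigma_r(\rho):=\int_{\mathbb{R}^d}\rho(x)\,j^\sigma_r(x,\rho)\,dx,\qquad j^\sigma_r(x,\rho):=-\int_{\mathbb{R}^d\setminus B_r(x)}\frac{\rho(y)}{|x-y|^{d+\sigma}}\,dy-\gamma^\sigma_r,$$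 and $\hat J^\sigma(\rho):=\lim_{r\to0^+}\hat J^\sigma_r(\rho)\in(-\infty,+\infty]$ (the limit exists since $r\mapsto\hat J^\sigma_r(\rho)$ is non-increasing). For $E\in\mathcal{M}_{\mathrm f}(\mathbb{R}^d)$, $\hat J^\sigma_r(E):=\hat J^\sigma_r(\chi_E)$ and $\hat J^\sigma(E):=\hat J^\sigma(\chi_E)$. $\Gamma$-convergence as $r\to0^+$ means: for every sequence $r_n\to0^+$, (liminf) $\hat J^\sigma(\rho)\le\liminf_n\hat J^\sigma_{r_n}(\rho_n)$ whenever $\rho_n\to\rho$ in $L^1$, and (limsup) for every $\rho$ there is $\rho_n\to\rho$ in $L^1$ with $\hat J^\sigma(\rho)\ge\limsup_n\hat J^\sigma_{r_n}(\rho_n)$; on $\mathcal{M}_{\mathrm f}(\mathbb{R}^d)$ all $\rho,\rho_n$ are characteristic functions. *)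

theory Defs
  imports "HOL-Analysis.Analysis"
begin

text \<open>
  The space \<open>\<real>\<^sup>d\<close>, \<open>d \<ge> 1\<close>, is a type \<open>'a\<close> of class \<open>euclidean_space\<close>, with \<open>d = DIM('a)\<close>.
  Elements of \<open>L\<^sup>1(\<real>\<^sup>d;[0,1])\<close> are represented by functions rather than by classes modulo
  equality almost everywhere; everything below is invariant under that equality.
\<close>

definition L1_unit :: "('a::euclidean_space \<Rightarrow> real) set" where
  "L1_unit = {\<rho>. integrable lebesgue \<rho> \<and> (AE x in lebesgue. 0 \<le> \<rho> x \<and> \<rho> x \<le> 1)}"

definition L1_tendsto :: "(nat \<Rightarrow> 'a::euclidean_space \<Rightarrow> real) \<Rightarrow> ('a \<Rightarrow> real) \<Rightarrow> bool" where
  "L1_tendsto \<rho>s \<rho> \<longleftrightarrow> (\<lambda>n. \<integral>x. \<bar>\<rho>s n x - \<rho> x\<bar> \<partial>lebesgue) \<longlonglongrightarrow> 0"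

text \<open>The first argument only supplies the space, hence \<open>d\<close> and \<open>\<omega>\<^sub>d\<close>.\<close>

definition gamma_const :: "'a::euclidean_space itself \<Rightarrow> real \<Rightarrow> real \<Rightarrow> real" where
  "gamma_const _ \<sigma> r =
     (if \<sigma> = 0 then real DIM('a) * measure lebesgue (ball (0::'a) 1) * ln r
      else real DIM('a) * measure lebesgue (ball (0::'a) 1) * ((1 - r powr (- \<sigma>)) / \<sigma>))"

text \<open>
  For \<open>r > 0\<close>, \<open>\<sigma> > -d\<close> and \<open>\<rho> \<in> L1_unit\<close> the kernel is bounded by \<open>r powr (-(d + \<sigma>))\<close> off the ball, so both
  integrands below are integrable and \<open>J_trunc\<close> is finite; it therefore takes real values.
\<close>

definition j_trunc :: "real \<Rightarrow> real \<Rightarrow> ('a::euclidean_space \<Rightarrow> real) \<Rightarrow> 'a \<Rightarrow> real" where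
  "j_trunc \<sigma> r \<rho> x =
     - (LINT y:(- ball x r)|lebesgue. \<rho> y / norm (x - y) powr (real DIM('a) + \<sigma>))
     - gamma_const TYPE('a) \<sigma> r"

definition J_trunc :: "real \<Rightarrow> real \<Rightarrow> ('a::euclidean_space \<Rightarrow> real) \<Rightarrow> real" where
  "J_trunc \<sigma> r \<rho> = (\<integral>x. \<rho> x * j_trunc \<sigma> r \<rho> x \<partial>lebesgue)"

definition J_lim :: "real \<Rightarrow> ('a::euclidean_space \<Rightarrow> real) \<Rightarrow> ereal" where
  "J_lim \<sigma> \<rho> = Lim (at_right 0) (\<lambda>r. ereal (J_trunc \<sigma> r \<rho>))"

text \<open>
  \<open>\<Gamma>\<close>-convergence, as \<open>r \<rightarrow> 0\<^sup>+\<close>, of the functionals \<open>F r\<close> to \<open>F0\<close> on the set \<open>X\<close>, with respect to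
  the notion \<open>conv\<close> of convergence of sequences.
\<close>

definition Gamma_limit_at_0 ::
  "'f set \<Rightarrow> ((nat \<Rightarrow> 'f) \<Rightarrow> 'f \<Rightarrow> bool) \<Rightarrow> (real \<Rightarrow> 'f \<Rightarrow> ereal) \<Rightarrow> ('f \<Rightarrow> ereal) \<Rightarrow> bool" where
  "Gamma_limit_at_0 X conv F F0 \<longleftrightarrow>
     (\<forall>r :: nat \<Rightarrow> real. (\<forall>n. 0 < r n) \<and> r \<longlonglongrightarrow> 0 \<longrightarrow>
        (\<forall>u\<in>X. \<forall>us. (\<forall>n. us n \<in> X) \<and> conv us u \<longrightarrow> F0 u \<le> liminf (\<lambda>n. F (r n) (us n))) \<and>
        (\<forall>u\<in>X. \<exists>us. (\<forall>n. us n \<in> X) \<and> conv us u \<and> limsup (\<lambda>n. F (r n) (us n)) \<le> F0 u))"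

end

theory Submission
  imports Defs
begin

text \<open>
  Off the ball the kernel is bounded by \<open>1 / r powr (d + \<sigma>)\<close>, so the truncated functional is a bounded
  bilinear form on \<open>L\<^sup>1\<close> evaluated on the diagonal plus a bounded linear form, hence continuous. The
  constant \<open>\<gamma>\<close> is chosen so that \<open>\<gamma> s - \<gamma> r\<close> is exactly the integral of the kernel over the annulus of
  radii \<open>r\<close> and \<open>s\<close>; as \<open>\<rho> \<le> 1\<close>, this makes the truncated functionals non-increasing in \<open>r\<close>. Their limit
  is therefore a supremum of continuous functionals, which is lower semicontinuous, and monotonicity
  together with constant recovery sequences gives the \<open>\<Gamma>\<close>-limit.
\<close>

section \<open>The truncated kernel and its potential\<close>

text \<open>The cut-off is a factor of the kernel rather than a domain of integration, so that all
  integrals run over the whole space and differences of truncations can be taken pointwise. The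
  exponent \<open>p\<close> stands for \<open>d + \<sigma>\<close>.\<close>

definition trunc_kernel :: "real \<Rightarrow> real \<Rightarrow> 'a::euclidean_space \<Rightarrow> 'a \<Rightarrow> real" where
  "trunc_kernel p r x y = indicator (- ball x r) y / norm (x - y) powr p"

definition trunc_potential :: "real \<Rightarrow> real \<Rightarrow> ('a::euclidean_space \<Rightarrow> real) \<Rightarrow> 'a \<Rightarrow> real" where
  "trunc_potential p r f x = (\<integral>y. f y * trunc_kernel p r x y \<partial>lebesgue)"

text \<open>For \<open>0 \<le> p\<close> the power decreases with the distance, and off the ball the
  distance is at least \<open>r\<close>. The condition on \<open>p\<close> is where
  \<open>\<sigma> > -d\<close> enters.\<close>

lemma trunc_kernel_bounds:
  assumes "0 < r" "0 \<le> p"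
  shows "0 \<le> trunc_kernel p r x y" "trunc_kernel p r x y \<le> 1 / r powr p"
proof -
  show "0 \<le> trunc_kernel p r x y"
    by (simp add: trunc_kernel_def)
  have "1 / norm (x - y) powr p \<le> 1 / r powr p" if "r \<le> norm (x - y)"
    using assms that by (intro divide_left_mono powr_mono2 mult_pos_pos) auto
  then show "trunc_kernel p r x y \<le> 1 / r powr p"
    by (auto simp: trunc_kernel_def indicator_def dist_norm)
qed

lemma borel_measurable_trunc_kernel [measurable]:
  "(\<lambda>(x, y). trunc_kernel p r x y) \<in> borel_measurable (borel \<Otimes>\<^sub>M borel)"
proof -
  \<comment> \<open>The ball moves with \<open>x\<close>; writing its indicator as a condition on
    the distance makes joint measurability in both variables visible.\<close>
  have "(\<lambda>z::'a \<times> 'a. trunc_kernel p r (fst z) (snd z))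
      = (\<lambda>z. (if dist (fst z) (snd z) < r then 0 else 1) / norm (fst z - snd z) powr p)"
    by (auto simp: trunc_kernel_def indicator_def fun_eq_iff)
  also have "\<dots> \<in> borel_measurable (borel \<Otimes>\<^sub>M borel)"
    by measurable
  finally show ?thesis
    by (simp add: case_prod_unfold)
qed

lemma borel_measurable_trunc_kernel_lebesgue [measurable]:
  "trunc_kernel p r x \<in> borel_measurable lebesgue"
proof -
  have "(\<lambda>y. trunc_kernel p r x y) \<in> borel_measurable borel"
    by measurable
  then show ?thesis
    by (simp add: measurable_completion)
qed

lemma integrable_mult_trunc_kernel:
  assumes "0 < r" "0 \<le> p" "integrable lebesgue f"
  shows "integrable lebesgue (\<lambda>y. f y * trunc_kernel p r x y)"
proof (rule Bochner_Integration.integrable_bound)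
  show "integrable lebesgue (\<lambda>y. f y * (1 / r powr p))"
    using assms by simp
  show "(\<lambda>y. f y * trunc_kernel p r x y) \<in> borel_measurable lebesgue"
    using assms(3) by measurable
  have "\<bar>trunc_kernel p r x y\<bar> \<le> \<bar>1 / r powr p\<bar>" for y
    using trunc_kernel_bounds[OF assms(1,2), of x y] by auto
  then show "AE y in lebesgue. norm (f y * trunc_kernel p r x y) \<le> norm (f y * (1 / r powr p))"
    unfolding real_norm_def abs_mult by (intro AE_I2 mult_left_mono) auto
qed

text \<open>The bound on the kernel makes the potential a bounded map from \<open>L\<^sup>1\<close>
  to bounded functions, uniformly in the point \<open>x\<close>.\<close>

lemma trunc_potential_abs_le:
  assumes "0 < r" "0 \<le> p" "integrable lebesgue f"
  shows "\<bar>trunc_potential p r f x\<bar> \<le> (\<integral>y. \<bar>f y\<bar> \<partial>lebesgue) / r powr p"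
proof -
  have "\<bar>trunc_potential p r f x\<bar> \<le> (\<integral>y. \<bar>f y * trunc_kernel p r x y\<bar> \<partial>lebesgue)"
    unfolding trunc_potential_def by (rule integral_abs_bound)
  also have "\<dots> \<le> (\<integral>y. \<bar>f y\<bar> * (1 / r powr p) \<partial>lebesgue)"
  proof (rule integral_mono)
    show "integrable lebesgue (\<lambda>y. \<bar>f y * trunc_kernel p r x y\<bar>)"
      using integrable_mult_trunc_kernel[OF assms] by simp
    show "integrable lebesgue (\<lambda>y. \<bar>f y\<bar> * (1 / r powr p))"
      using assms by simp
    show "\<bar>f y * trunc_kernel p r x y\<bar> \<le> \<bar>f y\<bar> * (1 / r powr p)" for y
      unfolding abs_mult
      using trunc_kernel_bounds[OF assms(1,2), of x y] by (intro mult_left_mono) auto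
  qed
  finally show ?thesis by simp
qed

text \<open>Lebesgue measurability of \<open>f\<close> does not carry over to the product measure, so \<open>f\<close> is first
  replaced by a Borel function.\<close>

lemma borel_measurable_trunc_potential:
  fixes f :: "'a::euclidean_space \<Rightarrow> real"
  assumes "f \<in> borel_measurable lebesgue"
  shows "trunc_potential p r f \<in> borel_measurable lebesgue"
proof -
  obtain g where g [measurable]: "g \<in> borel_measurable lborel" and ae: "AE x in lborel. f x = g x"
    using completion_ex_borel_measurable_real[OF assms] by blast
  \<comment> \<open>Equality holds at every \<open>x\<close>, not merely almost everywhere: changing
    \<open>f\<close> on a null set does not affect the integral in \<open>y\<close>.\<close>
  have "trunc_potential p r f = (\<lambda>x. \<integral>y. g y * trunc_kernel p r x y \<partial>lborel)"
  proof
    fix x :: 'a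
    have k: "(\<lambda>y. trunc_kernel p r x y) \<in> borel_measurable lborel"
      by measurable
    have "trunc_potential p r f x = (\<integral>y. g y * trunc_kernel p r x y \<partial>lebesgue)"
      unfolding trunc_potential_def
    proof (rule integral_cong_AE)
      show "(\<lambda>y. f y * trunc_kernel p r x y) \<in> borel_measurable lebesgue"
        using assms by measurable
      show "(\<lambda>y. g y * trunc_kernel p r x y) \<in> borel_measurable lebesgue"
        using measurable_completion[OF g] by measurable
      show "AE y in lebesgue. f y * trunc_kernel p r x y = g y * trunc_kernel p r x y"
        using AE_completion[OF ae] by eventually_elim simp
    qed
    also have "\<dots> = (\<integral>y. g y * trunc_kernel p r x y \<partial>lborel)"
      using k by (intro integral_completion) measurable
    finally show "trunc_potential p r f x = (\<integral>y. g y * trunc_kernel p r x y \<partial>lborel)" .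
  qed
  moreover have "(\<lambda>x. \<integral>y. g y * trunc_kernel p r x y \<partial>lborel) \<in> borel_measurable lborel"
    by measurable
  ultimately show ?thesis
    by (simp add: measurable_completion)
qed

text \<open>Integrating the uniform bound on the potential of \<open>f\<close> against
  \<open>g\<close> shows that the pairing is a bounded bilinear form on
  \<open>L\<^sup>1\<close>.\<close>

lemma
  fixes f g :: "'a::euclidean_space \<Rightarrow> real"
  assumes "0 < r" "0 \<le> p" "integrable lebesgue f" "integrable lebesgue g"
  shows integrable_mult_trunc_potential:
      "integrable lebesgue (\<lambda>x. g x * trunc_potential p r f x)" (is ?int)
    and integral_mult_trunc_potential_abs_le:
      "\<bar>\<integral>x. g x * trunc_potential p r f x \<partial>lebesgue\<bar>
        \<le> (\<integral>x. \<bar>g x\<bar> \<partial>lebesgue) * (\<integral>x. \<bar>f x\<bar> \<partial>lebesgue) / r powr p" (is ?le)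
proof -
  define C where "C = (\<integral>x. \<bar>f x\<bar> \<partial>lebesgue) / r powr p"
  have le: "\<bar>g x * trunc_potential p r f x\<bar> \<le> \<bar>g x\<bar> * C" for x
    unfolding abs_mult C_def by (intro mult_left_mono trunc_potential_abs_le assms) auto
  have int: "integrable lebesgue (\<lambda>x. \<bar>g x\<bar> * C)"
    using assms by simp
  show ?int
  proof (rule Bochner_Integration.integrable_bound[OF int])
    show "(\<lambda>x. g x * trunc_potential p r f x) \<in> borel_measurable lebesgue"
      using assms by (intro borel_measurable_times borel_measurable_trunc_potential) auto
    show "AE x in lebesgue. norm (g x * trunc_potential p r f x) \<le> norm (\<bar>g x\<bar> * C)"
      using le order_trans[OF _ abs_ge_self] by auto
  qed
  then have "\<bar>\<integral>x. g x * trunc_potential p r f x \<partial>lebesgue\<bar> \<le> (\<integral>x. \<bar>g x\<bar> * C \<partial>lebesgue)"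
    by (intro order_trans[OF integral_abs_bound] integral_mono) (use le int in auto)
  then show ?le
    by (simp add: C_def)
qed

section \<open>Continuity of the truncated functionals in \<open>L\<^sup>1\<close>\<close>

text \<open>Separates the quadratic part from the linear one, which is legitimate because each is
  integrable on its own.\<close>

lemma J_trunc_eq:
  fixes \<rho> :: "'a::euclidean_space \<Rightarrow> real"
  assumes "0 < r" "- real DIM('a) < \<sigma>" "integrable lebesgue \<rho>"
  shows "J_trunc \<sigma> r \<rho> =
    - (\<integral>x. \<rho> x * trunc_potential (real DIM('a) + \<sigma>) r \<rho> x \<partial>lebesgue)
    - gamma_const TYPE('a) \<sigma> r * (\<integral>x. \<rho> x \<partial>lebesgue)"
proof -
  have "j_trunc \<sigma> r \<rho> x = - trunc_potential (real DIM('a) + \<sigma>) r \<rho> x - gamma_const TYPE('a) \<sigma> r"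
    for x
    by (simp add: j_trunc_def trunc_potential_def trunc_kernel_def set_lebesgue_integral_def
        mult.commute)
  then have "J_trunc \<sigma> r \<rho> =
      (\<integral>x. - (\<rho> x * trunc_potential (real DIM('a) + \<sigma>) r \<rho> x)
            - gamma_const TYPE('a) \<sigma> r * \<rho> x \<partial>lebesgue)"
    by (simp add: J_trunc_def right_diff_distrib mult.commute)
  also have "\<dots> = - (\<integral>x. \<rho> x * trunc_potential (real DIM('a) + \<sigma>) r \<rho> x \<partial>lebesgue)
      - gamma_const TYPE('a) \<sigma> r * (\<integral>x. \<rho> x \<partial>lebesgue)"
    using assms integrable_mult_trunc_potential[of r "real DIM('a) + \<sigma>" \<rho> \<rho>] by simp
  finally show ?thesis .
qed

lemma trunc_potential_diff:
  assumes "0 < r" "0 \<le> p" "integrable lebesgue f" "integrable lebesgue g"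
  shows "trunc_potential p r (\<lambda>y. f y - g y) x = trunc_potential p r f x - trunc_potential p r g x"
  using integrable_mult_trunc_kernel[OF assms(1,2), of _ x] assms(3,4)
  by (simp add: trunc_potential_def left_diff_distrib)

text \<open>The reverse triangle inequality, applied pointwise and integrated. It keeps the norms of
  the sequence under control in the quadratic term.\<close>

lemma L1_tendsto_abs_integral:
  assumes "\<And>n. integrable lebesgue (\<rho>s n)" "integrable lebesgue \<rho>" "L1_tendsto \<rho>s \<rho>"
  shows "(\<lambda>n. \<integral>x. \<bar>\<rho>s n x\<bar> \<partial>lebesgue) \<longlonglongrightarrow> (\<integral>x. \<bar>\<rho> x\<bar> \<partial>lebesgue)"
proof (rule LIM_zero_cancel, rule Lim_null_comparison)
  show "(\<lambda>n. \<integral>x. \<bar>\<rho>s n x - \<rho> x\<bar> \<partial>lebesgue) \<longlonglongrightarrow> 0"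
    using assms(3) by (simp add: L1_tendsto_def)
  have "norm ((\<integral>x. \<bar>\<rho>s n x\<bar> \<partial>lebesgue) - (\<integral>x. \<bar>\<rho> x\<bar> \<partial>lebesgue))
      \<le> (\<integral>x. \<bar>\<rho>s n x - \<rho> x\<bar> \<partial>lebesgue)" for n
  proof -
    note int = assms(1)[of n] assms(2)
    have "norm ((\<integral>x. \<bar>\<rho>s n x\<bar> \<partial>lebesgue) - (\<integral>x. \<bar>\<rho> x\<bar> \<partial>lebesgue))
        = \<bar>\<integral>x. \<bar>\<rho>s n x\<bar> - \<bar>\<rho> x\<bar> \<partial>lebesgue\<bar>"
      using int by simp
    also have "\<dots> \<le> (\<integral>x. \<bar>\<bar>\<rho>s n x\<bar> - \<bar>\<rho> x\<bar>\<bar> \<partial>lebesgue)"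
      by (rule integral_abs_bound)
    also have "\<dots> \<le> (\<integral>x. \<bar>\<rho>s n x - \<rho> x\<bar> \<partial>lebesgue)"
      using int by (intro integral_mono abs_triangle_ineq3 integrable_abs Bochner_Integration.integrable_diff)
    finally show ?thesis .
  qed
  then show "\<forall>\<^sub>F n in sequentially. norm ((\<integral>x. \<bar>\<rho>s n x\<bar> \<partial>lebesgue) - (\<integral>x. \<bar>\<rho> x\<bar> \<partial>lebesgue))
      \<le> (\<integral>x. \<bar>\<rho>s n x - \<rho> x\<bar> \<partial>lebesgue)"
    by simp
qed

lemma L1_tendsto_integral:
  assumes "\<And>n. integrable lebesgue (\<rho>s n)" "integrable lebesgue \<rho>" "L1_tendsto \<rho>s \<rho>"
  shows "(\<lambda>n. \<integral>x. \<rho>s n x \<partial>lebesgue) \<longlonglongrightarrow> (\<integral>x. \<rho> x \<partial>lebesgue)"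
proof (rule LIM_zero_cancel, rule Lim_null_comparison)
  show "(\<lambda>n. \<integral>x. \<bar>\<rho>s n x - \<rho> x\<bar> \<partial>lebesgue) \<longlonglongrightarrow> 0"
    using assms(3) by (simp add: L1_tendsto_def)
  have "norm ((\<integral>x. \<rho>s n x \<partial>lebesgue) - (\<integral>x. \<rho> x \<partial>lebesgue)) \<le> (\<integral>x. \<bar>\<rho>s n x - \<rho> x\<bar> \<partial>lebesgue)" for n
    using integral_abs_bound[of lebesgue "\<lambda>x. \<rho>s n x - \<rho> x"] assms(1,2) by simp
  then show "\<forall>\<^sub>F n in sequentially. norm ((\<integral>x. \<rho>s n x \<partial>lebesgue) - (\<integral>x. \<rho> x \<partial>lebesgue))
      \<le> (\<integral>x. \<bar>\<rho>s n x - \<rho> x\<bar> \<partial>lebesgue)"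
    by simp
qed

lemma J_trunc_continuous:
  fixes \<rho> :: "'a::euclidean_space \<Rightarrow> real"
  assumes "0 < r" "- real DIM('a) < \<sigma>"
    and int: "\<And>n. integrable lebesgue (\<rho>s n)" "integrable lebesgue \<rho>"
    and conv: "L1_tendsto \<rho>s \<rho>"
  shows "(\<lambda>n. J_trunc \<sigma> r (\<rho>s n)) \<longlonglongrightarrow> J_trunc \<sigma> r \<rho>"
proof -
  define p where "p = real DIM('a) + \<sigma>"
  have p: "0 \<le> p"
    using assms by (simp add: p_def)
  define B where "B f g = (\<integral>x. f x * trunc_potential p r g x \<partial>lebesgue)" for f g :: "'a \<Rightarrow> real"
  define N where "N f = (\<integral>x. \<bar>f x\<bar> \<partial>lebesgue)" for f :: "'a \<Rightarrow> real"
  note Bint = integrable_mult_trunc_potential[OF \<open>0 < r\<close> p]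
  have B_le: "\<bar>B f g\<bar> \<le> N f * N g / r powr p" if "integrable lebesgue f" "integrable lebesgue g" for f g
    using integral_mult_trunc_potential_abs_le[OF \<open>0 < r\<close> p that(2,1)] by (simp add: B_def N_def)
  have "(\<lambda>n. B (\<rho>s n) (\<rho>s n)) \<longlonglongrightarrow> B \<rho> \<rho>"
  proof (rule LIM_zero_cancel, rule Lim_null_comparison)
    define e where "e n x = \<rho>s n x - \<rho> x" for n x
    have e: "integrable lebesgue (e n)" for n
      unfolding e_def using int by simp
    \<comment> \<open>Bilinearity: the mixed term \<open>B \<rho> (\<rho>s n)\<close> is subtracted
      and added, so each summand contains the error \<open>e n\<close> exactly once.\<close>
    have "B (\<rho>s n) (\<rho>s n) - B \<rho> \<rho> = B (e n) (\<rho>s n) + B \<rho> (e n)" for n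
      using Bint[OF int(1)[of n] int(1)[of n]] Bint[OF int(1)[of n] int(2)] Bint[OF int(2) int(2)] int
      by (simp add: B_def e_def[abs_def] trunc_potential_diff[OF \<open>0 < r\<close> p]
          left_diff_distrib right_diff_distrib)
    moreover have "\<bar>B (e n) (\<rho>s n) + B \<rho> (e n)\<bar>
        \<le> N (e n) * N (\<rho>s n) / r powr p + N \<rho> * N (e n) / r powr p" for n
      by (intro order_trans[OF abs_triangle_ineq] add_mono B_le e int)
    ultimately show "\<forall>\<^sub>F n in sequentially. norm (B (\<rho>s n) (\<rho>s n) - B \<rho> \<rho>)
        \<le> N (e n) * N (\<rho>s n) / r powr p + N \<rho> * N (e n) / r powr p"
      by simp
    have "(\<lambda>n. N (e n)) \<longlonglongrightarrow> 0"
      using conv by (simp add: L1_tendsto_def N_def e_def)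
    moreover have "(\<lambda>n. N (\<rho>s n)) \<longlonglongrightarrow> N \<rho>"
      unfolding N_def by (rule L1_tendsto_abs_integral[OF int conv])
    ultimately have "(\<lambda>n. N (e n) * N (\<rho>s n) / r powr p + N \<rho> * N (e n) / r powr p)
        \<longlonglongrightarrow> 0 * N \<rho> / r powr p + N \<rho> * 0 / r powr p"
      using \<open>0 < r\<close> by (intro tendsto_intros) auto
    then show "(\<lambda>n. N (e n) * N (\<rho>s n) / r powr p + N \<rho> * N (e n) / r powr p) \<longlonglongrightarrow> 0"
      by simp
  qed
  then show ?thesis
    unfolding J_trunc_eq[OF assms(1,2) int(1)] J_trunc_eq[OF assms(1,2) int(2)] B_def p_def
    by (intro tendsto_diff tendsto_minus tendsto_mult_left L1_tendsto_integral[OF int conv])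
qed

section \<open>The integral of the kernel over an annulus\<close>

lemma trunc_kernel_diff:
  assumes "r \<le> s"
  shows "trunc_kernel p r x y - trunc_kernel p s x y
    = indicator (ball x s - ball x r) y / norm (x - y) powr p"
  using assms by (auto simp: trunc_kernel_def indicator_def)

text \<open>\<open>V t\<close> is the volume of a ball of radius \<open>t\<close>, so
  \<open>V s - V r\<close> is that of the annulus. On it the kernel lies between its values at
  distances \<open>s\<close> and \<open>r\<close>.\<close>

lemma
  fixes x :: "'a::euclidean_space"
  assumes "0 < r" "r \<le> s" "0 \<le> p"
  defines "V \<equiv> \<lambda>t. measure lebesgue (ball (0::'a) 1) * t ^ DIM('a)"
  shows integrable_annulus: "integrable lebesgue
      (\<lambda>y. indicator (ball x s - ball x r) y / norm (x - y) powr p)" (is "integrable _ ?f")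
    and integral_annulus_lower:
      "(V s - V r) * s powr (-p) \<le> integral\<^sup>L lebesgue
        (\<lambda>y. indicator (ball x s - ball x r) y / norm (x - y) powr p)"
    and integral_annulus_upper:
      "integral\<^sup>L lebesgue (\<lambda>y. indicator (ball x s - ball x r) y / norm (x - y) powr p)
        \<le> (V s - V r) * r powr (-p)"
proof -
  let ?A = "ball x s - ball x r"
  have A: "?A \<in> lmeasurable"
    by (intro fmeasurable.Diff) auto
  have ball: "measure lebesgue (ball x t) = V t" if "0 \<le> t" for t
    using content_ball[of 1 "0::'a"] content_ball[OF that, of x] by (simp add: V_def)
  have "measure lebesgue ?A = measure lebesgue (ball x s) - measure lebesgue (ball x r)"
    using assms by (intro measurable_measure_Diff) auto
  then have meas: "measure lebesgue ?A = V s - V r"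
    using assms ball[of s] ball[of r] by linarith
  have int: "integrable lebesgue (\<lambda>y. indicator ?A y * c)" for c :: real
    using A by (simp add: lmeasurable_iff_integrable)
  have up: "?f y \<le> indicator ?A y * r powr (-p)" for y
    using assms powr_mono2'[of "-p" r "norm (x - y)"]
    by (auto simp: indicator_def dist_norm powr_minus_divide)
  \<comment> \<open>Monotonicity of a negative power needs a positive distance. The point
    \<open>y = x\<close> is treated apart: it lies in the inner ball, so both sides vanish
    there.\<close>
  have lo: "indicator ?A y * s powr (-p) \<le> ?f y" for y
    using assms powr_mono2'[of "-p" "norm (x - y)" s]
    by (cases "x = y") (auto simp: indicator_def dist_norm powr_minus_divide)
  have "?f = (\<lambda>y. trunc_kernel p r x y - trunc_kernel p s x y)"
    by (simp add: trunc_kernel_diff[OF \<open>r \<le> s\<close>])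
  then have f: "?f \<in> borel_measurable lebesgue"
    by simp
  show f_int: "integrable lebesgue ?f"
    by (rule Bochner_Integration.integrable_bound[OF int[of "r powr (-p)"] f])
      (use up in \<open>auto intro!: AE_I2\<close>)
  show "(V s - V r) * s powr (-p) \<le> integral\<^sup>L lebesgue ?f"
    using integral_mono[OF int f_int lo] A by (simp add: meas)
  show "integral\<^sup>L lebesgue ?f \<le> (V s - V r) * r powr (-p)"
    using integral_mono[OF f_int int up] A by (simp add: meas)
qed

text \<open>The derivative is \<open>d * \<omega> * t powr (- \<sigma> - 1)\<close>, with
  \<open>\<omega>\<close> the volume of the unit ball, both in the logarithmic case and otherwise.
  It is written as the derivative of the ball volume times the kernel at distance \<open>t\<close>,
  to match the derivative of the annulus integral.\<close>

lemma gamma_const_deriv: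
  assumes "0 < t"
  shows "(gamma_const TYPE('a::euclidean_space) \<sigma> has_real_derivative
    measure lebesgue (ball (0::'a) 1) * (real DIM('a) * t ^ (DIM('a) - 1))
      * t powr (- (real DIM('a) + \<sigma>))) (at t)"
proof -
  have "t ^ (DIM('a) - 1) = t powr (real DIM('a) - 1)"
    using assms by (simp add: powr_realpow[symmetric] of_nat_diff DIM_positive Suc_leI)
  moreover have "real DIM('a) - 1 + - (real DIM('a) + \<sigma>) = - \<sigma> - 1"
    by simp
  ultimately have t: "t ^ (DIM('a) - 1) * t powr (- (real DIM('a) + \<sigma>)) = t powr (- \<sigma> - 1)"
    by (metis powr_add)
  define c where "c = real DIM('a) * measure lebesgue (ball (0::'a) 1)"
  have "(gamma_const TYPE('a) \<sigma> has_real_derivative c * t powr (- \<sigma> - 1)) (at t)"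
  proof (cases "\<sigma> = 0")
    case True
    then have "gamma_const TYPE('a) \<sigma> = (\<lambda>r. c * ln r)"
      by (simp add: gamma_const_def c_def fun_eq_iff)
    moreover have "t powr (- \<sigma> - 1) = 1 / t"
      using True assms by (simp add: powr_minus_divide)
    ultimately show ?thesis
      using assms by (auto intro!: derivative_eq_intros)
  next
    case False
    then have "gamma_const TYPE('a) \<sigma> = (\<lambda>r. c * ((1 - r powr (- \<sigma>)) / \<sigma>))"
      by (simp add: gamma_const_def c_def fun_eq_iff)
    then show ?thesis
      using assms False by (auto intro!: derivative_eq_intros)
  qed
  then show ?thesis
    unfolding t[symmetric] c_def by (simp only: mult_ac)
qed

text \<open>Polar coordinates are replaced by differentiation in the outer radius: squeezing the kernel
  between its values on the two bounding spheres shows that both sides have the same derivative.\<close>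

lemma integral_annulus:
  fixes x :: "'a::euclidean_space"
  assumes "0 < r" "r \<le> s" "- real DIM('a) < \<sigma>"
  shows "(\<integral>y. indicator (ball x s - ball x r) y / norm (x - y) powr (real DIM('a) + \<sigma>) \<partial>lebesgue)
    = gamma_const TYPE('a) \<sigma> s - gamma_const TYPE('a) \<sigma> r"
proof -
  define p where "p = real DIM('a) + \<sigma>"
  have p: "0 \<le> p"
    using assms by (simp add: p_def)
  define A where "A u v = (\<integral>y. indicator (ball x v - ball x u) y / norm (x - y) powr p \<partial>lebesgue)"
    for u v
  define V where "V t = measure lebesgue (ball (0::'a) 1) * t ^ DIM('a)" for t
  define G where "G = gamma_const TYPE('a) \<sigma>"
  have add: "A u w = A u v + A v w" if "0 < u" "u \<le> v" "v \<le> w" for u v w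
  proof -
    have "A u w = (\<integral>y. indicator (ball x v - ball x u) y / norm (x - y) powr p
        + indicator (ball x w - ball x v) y / norm (x - y) powr p \<partial>lebesgue)"
      unfolding A_def using that
      by (intro Bochner_Integration.integral_cong) (auto simp: indicator_def)
    also have "\<dots> = A u v + A v w"
      unfolding A_def using that p
      by (intro Bochner_Integration.integral_add integrable_annulus) auto
    finally show ?thesis .
  qed
  \<comment> \<open>An inner radius strictly below \<open>r\<close> lets the outer radius vary on
    both sides of every \<open>t \<ge> r\<close>, so that the derivative is two-sided even at
    \<open>t = r\<close>.\<close>
  define a where "a = r / 2"
  have a: "0 < a" "a < r"
    using assms by (auto simp: a_def)
  have V_mono: "V u \<le> V v" if "0 \<le> u" "u \<le> v" for u v
    unfolding V_def using that by (intro mult_left_mono power_mono) auto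
  \<comment> \<open>By additivity the increment of \<open>A a\<close> is the integral over the
    annulus between \<open>u\<close> and \<open>v\<close>, to which the squeeze applies.\<close>
  have bounds: "(V v - V u) * v powr (-p) \<le> A a v - A a u"
      "A a v - A a u \<le> (V v - V u) * u powr (-p)" if "a \<le> u" "u \<le> v" for u v
    using add[of a u v] a that p integral_annulus_lower[of u v p x] integral_annulus_upper[of u v p x]
    by (auto simp: A_def V_def)
  have deriv: "(A a has_real_derivative
      measure lebesgue (ball (0::'a) 1) * (real DIM('a) * t ^ (DIM('a) - 1)) * t powr (-p)) (at t)"
    if "r \<le> t" for t
  proof -
    let ?D = "measure lebesgue (ball (0::'a) 1) * (real DIM('a) * t ^ (DIM('a) - 1))"
    have "(V has_real_derivative ?D) (at t)"
      unfolding V_def[abs_def] by (auto intro!: derivative_eq_intros)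
    then have V: "(\<lambda>v. (V v - V t) / (v - t)) \<midarrow>t\<rightarrow> ?D"
      by (simp add: has_field_derivative_iff)
    \<comment> \<open>Replacing the kernel on the thin annulus by its value at distance
      \<open>t\<close> costs at most the volume quotient, which converges, times the oscillation of
      the kernel, which tends to 0.\<close>
    have "((\<lambda>v. (A a v - A a t) / (v - t) - (V v - V t) / (v - t) * t powr (-p)) \<longlongrightarrow> 0) (at t)"
    proof (rule Lim_null_comparison)
      have "((\<lambda>v. v powr (-p)) \<longlongrightarrow> t powr (-p)) (at t)"
        using a that by (intro tendsto_intros) auto
      with V have "((\<lambda>v. \<bar>(V v - V t) / (v - t)\<bar> * \<bar>v powr (-p) - t powr (-p)\<bar>)
          \<longlongrightarrow> \<bar>?D\<bar> * \<bar>t powr (-p) - t powr (-p)\<bar>) (at t)"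
        by (intro tendsto_mult tendsto_rabs tendsto_diff tendsto_const)
      then show "((\<lambda>v. \<bar>(V v - V t) / (v - t)\<bar> * \<bar>v powr (-p) - t powr (-p)\<bar>) \<longlongrightarrow> 0) (at t)"
        by simp
      have "norm ((A a v - A a t) / (v - t) - (V v - V t) / (v - t) * t powr (-p))
          \<le> \<bar>(V v - V t) / (v - t)\<bar> * \<bar>v powr (-p) - t powr (-p)\<bar>" if "a < v" for v
      proof -
        have "\<bar>(A a v - A a t) - (V v - V t) * t powr (-p)\<bar>
            \<le> \<bar>V v - V t\<bar> * \<bar>v powr (-p) - t powr (-p)\<bar>"
        \<comment> \<open>The order of \<open>v\<close> and \<open>t\<close> fixes the sign of both
          factors on the right, since \<open>V\<close> increases and the power decreases; the
          squeeze then gives the bound on either side.\<close>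
        proof (cases "v \<le> t")
          case True
          have "\<bar>V v - V t\<bar> * \<bar>v powr (-p) - t powr (-p)\<bar> = (V t - V v) * (v powr (-p) - t powr (-p))"
            using V_mono[of v t] True a that p powr_mono2'[of "-p" v t] by (auto simp: abs_if)
          then show ?thesis
            using bounds[of v t] True that by (auto simp: algebra_simps)
        next
          case False
          have "\<bar>V v - V t\<bar> * \<bar>v powr (-p) - t powr (-p)\<bar> = (V v - V t) * (t powr (-p) - v powr (-p))"
            using V_mono[of t v] False a \<open>r \<le> t\<close> p powr_mono2'[of "-p" t v] by (auto simp: abs_if)
          then show ?thesis
            using bounds[of t v] False a \<open>r \<le> t\<close> by (auto simp: algebra_simps)
        qed
        then have "\<bar>(A a v - A a t) - (V v - V t) * t powr (-p)\<bar> / \<bar>v - t\<bar>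
            \<le> \<bar>V v - V t\<bar> * \<bar>v powr (-p) - t powr (-p)\<bar> / \<bar>v - t\<bar>"
          by (intro divide_right_mono) auto
        moreover have "(A a v - A a t) / (v - t) - (V v - V t) / (v - t) * t powr (-p)
            = ((A a v - A a t) - (V v - V t) * t powr (-p)) / (v - t)"
          by (simp add: diff_divide_distrib[of "A a v - A a t"])
        ultimately show ?thesis
          by (simp add: abs_divide)
      qed
      moreover have "\<forall>\<^sub>F v in at t. a < v"
        using a that by (intro order_tendstoD(1)[OF tendsto_ident_at]) auto
      ultimately show "\<forall>\<^sub>F v in at t. norm ((A a v - A a t) / (v - t) - (V v - V t) / (v - t) * t powr (-p))
          \<le> \<bar>(V v - V t) / (v - t)\<bar> * \<bar>v powr (-p) - t powr (-p)\<bar>"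
        by (auto elim: eventually_mono)
    qed
    from tendsto_add[OF this tendsto_mult_right[OF V, of "t powr (-p)"]] show ?thesis
      by (simp add: has_field_derivative_iff)
  qed
  \<comment> \<open>The difference has derivative zero on the interval from \<open>r\<close> to
    \<open>s\<close>, hence equal values at its ends; additivity then removes the auxiliary radius
    \<open>a\<close>.\<close>
  have "A a s - G s = A a r - G r"
  proof (cases "r = s")
    case False
    have D: "((\<lambda>t. A a t - G t) has_real_derivative 0) (at t)" if "r \<le> t" for t
      using DERIV_diff[OF deriv[OF that] gamma_const_deriv[of t \<sigma>, where 'a='a]] that assms
      by (simp add: G_def p_def)
    show ?thesis
      using assms False
      by (intro DERIV_isconst_end[of r s "\<lambda>t. A a t - G t"])
        (auto intro!: D continuous_at_imp_continuous_on DERIV_isCont)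
  qed simp
  then show ?thesis
    using add[of a r s] a assms by (simp add: A_def G_def p_def)
qed

section \<open>Monotonicity in the radius and the monotone limit\<close>

lemma J_trunc_antimono:
  fixes \<rho> :: "'a::euclidean_space \<Rightarrow> real"
  assumes "0 < r" "r \<le> s" and \<sigma>: "- real DIM('a) < \<sigma>" and \<rho>: "\<rho> \<in> L1_unit"
  shows "J_trunc \<sigma> s \<rho> \<le> J_trunc \<sigma> r \<rho>"
proof -
  define p where "p = real DIM('a) + \<sigma>"
  have p: "0 \<le> p" and s: "0 < s"
    using assms by (auto simp: p_def)
  have int: "integrable lebesgue \<rho>" and ae: "AE x in lebesgue. 0 \<le> \<rho> x \<and> \<rho> x \<le> 1"
    using \<rho> by (auto simp: L1_unit_def)
  let ?c = "gamma_const TYPE('a) \<sigma> s - gamma_const TYPE('a) \<sigma> r"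
  have le: "trunc_potential p r \<rho> x - trunc_potential p s \<rho> x \<le> ?c" for x
  proof -
    have k: "integrable lebesgue (\<lambda>y. \<rho> y * trunc_kernel p r x y)"
        "integrable lebesgue (\<lambda>y. \<rho> y * trunc_kernel p s x y)"
      using integrable_mult_trunc_kernel p s \<open>0 < r\<close> int by auto
    have "trunc_potential p r \<rho> x - trunc_potential p s \<rho> x
        = (\<integral>y. \<rho> y * (trunc_kernel p r x y - trunc_kernel p s x y) \<partial>lebesgue)"
      using k by (simp add: trunc_potential_def right_diff_distrib)
    \<comment> \<open>Here \<open>\<rho> \<le> 1\<close> enters: the density is replaced by 1 on the
      annulus, whose kernel integral is exactly the difference of the constants.\<close>
    also have "\<dots> \<le> (\<integral>y. trunc_kernel p r x y - trunc_kernel p s x y \<partial>lebesgue)"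
    proof (rule integral_mono_AE)
      show "integrable lebesgue (\<lambda>y. \<rho> y * (trunc_kernel p r x y - trunc_kernel p s x y))"
        using k by (simp add: right_diff_distrib)
      show "integrable lebesgue (\<lambda>y. trunc_kernel p r x y - trunc_kernel p s x y)"
        unfolding trunc_kernel_diff[OF \<open>r \<le> s\<close>] using assms p by (intro integrable_annulus)
      have nonneg: "0 \<le> trunc_kernel p r x y - trunc_kernel p s x y" for y
        unfolding trunc_kernel_diff[OF \<open>r \<le> s\<close>] by simp
      show "AE y in lebesgue. \<rho> y * (trunc_kernel p r x y - trunc_kernel p s x y)
          \<le> trunc_kernel p r x y - trunc_kernel p s x y"
        using ae by eventually_elim (use nonneg in \<open>auto intro: mult_left_le_one_le\<close>)
    qed
    also have "\<dots> = ?c"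
      unfolding trunc_kernel_diff[OF \<open>r \<le> s\<close>] p_def using assms by (intro integral_annulus)
    finally show ?thesis .
  qed
  have P: "integrable lebesgue (\<lambda>x. \<rho> x * trunc_potential p r \<rho> x)"
      "integrable lebesgue (\<lambda>x. \<rho> x * trunc_potential p s \<rho> x)"
    using integrable_mult_trunc_potential p s \<open>0 < r\<close> int by auto
  \<comment> \<open>The integrand is nonnegative by \<open>le\<close> and
    \<open>\<rho> \<ge> 0\<close>; its integral turns out to be the difference of the two truncated
    functionals.\<close>
  have "0 \<le> (\<integral>x. \<rho> x * (?c - (trunc_potential p r \<rho> x - trunc_potential p s \<rho> x)) \<partial>lebesgue)"
  proof (rule integral_nonneg_AE)
    show "AE x in lebesgue. 0 \<le> \<rho> x * (?c - (trunc_potential p r \<rho> x - trunc_potential p s \<rho> x))"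
      using ae by eventually_elim (use le in auto)
  qed
  also have "\<dots> = (\<integral>x. ?c * \<rho> x - (\<rho> x * trunc_potential p r \<rho> x - \<rho> x * trunc_potential p s \<rho> x) \<partial>lebesgue)"
    by (intro Bochner_Integration.integral_cong) (auto simp: algebra_simps)
  also have "\<dots> = ?c * (\<integral>x. \<rho> x \<partial>lebesgue) - ((\<integral>x. \<rho> x * trunc_potential p r \<rho> x \<partial>lebesgue)
      - (\<integral>x. \<rho> x * trunc_potential p s \<rho> x \<partial>lebesgue))"
    using P int by simp
  also have "\<dots> = J_trunc \<sigma> r \<rho> - J_trunc \<sigma> s \<rho>"
    using J_trunc_eq[OF \<open>0 < r\<close> \<sigma> int] J_trunc_eq[OF s \<sigma> int] by (simp add: p_def algebra_simps)
  finally show ?thesis by simp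
qed

text \<open>If \<open>f s\<close> exceeds a number below the supremum, so do all values on
  \<open>{0<..<s}\<close>, and no value exceeds the supremum.\<close>

lemma antimono_on_tendsto_SUP_at_right:
  fixes f :: "real \<Rightarrow> ereal"
  assumes "antimono_on {0<..} f"
  shows "(f \<longlongrightarrow> (SUP r\<in>{0<..}. f r)) (at_right 0)"
proof (rule order_tendstoI)
  fix a assume "a < (SUP r\<in>{0<..}. f r)"
  then obtain s where s: "0 < s" "a < f s"
    by (auto simp: less_SUP_iff)
  have "\<forall>\<^sub>F r in at_right 0. r \<in> {0<..<s}"
    by (rule eventually_at_right_real[OF s(1)])
  then show "\<forall>\<^sub>F r in at_right 0. a < f r"
  proof eventually_elim
    case (elim r)
    then have "f s \<le> f r"
      using s by (intro monotone_onD[OF assms, of r s]) auto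
    with s show ?case by simp
  qed
next
  fix a assume a: "(SUP r\<in>{0<..}. f r) < a"
  show "\<forall>\<^sub>F r in at_right 0. f r < a"
    by (intro eventually_at_right_less[THEN eventually_mono] le_less_trans[OF SUP_upper a]) auto
qed

lemma J_lim_tendsto:
  fixes \<rho> :: "'a::euclidean_space \<Rightarrow> real"
  assumes "- real DIM('a) < \<sigma>" "\<rho> \<in> L1_unit"
  shows "((\<lambda>r. ereal (J_trunc \<sigma> r \<rho>)) \<longlongrightarrow> J_lim \<sigma> \<rho>) (at_right 0)"
    and "J_lim \<sigma> \<rho> = (SUP r\<in>{0<..}. ereal (J_trunc \<sigma> r \<rho>))"
proof -
  have "antimono_on {0<..} (\<lambda>r. ereal (J_trunc \<sigma> r \<rho>))"
    using assms by (auto intro!: monotone_onI J_trunc_antimono)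
  from antimono_on_tendsto_SUP_at_right[OF this]
  have lim: "((\<lambda>r. ereal (J_trunc \<sigma> r \<rho>)) \<longlongrightarrow> (SUP r\<in>{0<..}. ereal (J_trunc \<sigma> r \<rho>))) (at_right 0)" .
  \<comment> \<open>\<open>Lim\<close> only names a limit once one is known to exist; uniqueness of
    limits along the nontrivial filter \<open>at_right 0\<close> then identifies it with the
    supremum.\<close>
  then show eq: "J_lim \<sigma> \<rho> = (SUP r\<in>{0<..}. ereal (J_trunc \<sigma> r \<rho>))"
    unfolding J_lim_def by (intro tendsto_Lim) auto
  show "((\<lambda>r. ereal (J_trunc \<sigma> r \<rho>)) \<longlongrightarrow> J_lim \<sigma> \<rho>) (at_right 0)"
    using lim by (simp add: eq)
qed

section \<open>Lower semicontinuity and \<open>\<Gamma>\<close>-convergence\<close>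

lemma J_trunc_le_J_lim:
  fixes \<rho> :: "'a::euclidean_space \<Rightarrow> real"
  assumes "- real DIM('a) < \<sigma>" "\<rho> \<in> L1_unit" "0 < r"
  shows "ereal (J_trunc \<sigma> r \<rho>) \<le> J_lim \<sigma> \<rho>"
  unfolding J_lim_tendsto(2)[OF assms(1,2)] using assms(3) by (intro SUP_upper) simp

text \<open>Covers the lower semicontinuity of \<open>J_lim\<close> and the liminf inequality at once: \<open>F n\<close> is
  \<open>J_lim\<close> or the truncated functional at radius \<open>r n\<close>.\<close>

lemma J_lim_le_liminf:
  fixes \<rho> :: "'a::euclidean_space \<Rightarrow> real"
  assumes \<sigma>: "- real DIM('a) < \<sigma>"
    and X: "\<And>n. \<rho>s n \<in> L1_unit" "\<rho> \<in> L1_unit" and conv: "L1_tendsto \<rho>s \<rho>"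
    and F: "\<And>s. 0 < s \<Longrightarrow> \<forall>\<^sub>F n in sequentially. ereal (J_trunc \<sigma> s (\<rho>s n)) \<le> F n"
  shows "J_lim \<sigma> \<rho> \<le> liminf F"
  unfolding J_lim_tendsto(2)[OF \<sigma> X(2)]
\<comment> \<open>It suffices to bound each truncation at a fixed radius \<open>s\<close>, where
  continuity turns the liminf into a limit.\<close>
proof (rule SUP_least)
  fix s :: real assume "s \<in> {0<..}"
  then have s: "0 < s" by simp
  have "(\<lambda>n. ereal (J_trunc \<sigma> s (\<rho>s n))) \<longlonglongrightarrow> ereal (J_trunc \<sigma> s \<rho>)"
    using X by (intro tendsto_intros J_trunc_continuous s \<sigma> conv) (auto simp: L1_unit_def)
  then have "ereal (J_trunc \<sigma> s \<rho>) = liminf (\<lambda>n. ereal (J_trunc \<sigma> s (\<rho>s n)))"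
    by (intro lim_imp_Liminf[symmetric]) auto
  also have "\<dots> \<le> liminf F"
    by (rule Liminf_mono[OF F[OF s]])
  finally show "ereal (J_trunc \<sigma> s \<rho>) \<le> liminf F" .
qed

lemma J_lim_lower_semicontinuous:
  fixes \<rho> :: "'a::euclidean_space \<Rightarrow> real"
  assumes "- real DIM('a) < \<sigma>" "\<And>n. \<rho>s n \<in> L1_unit" "\<rho> \<in> L1_unit" "L1_tendsto \<rho>s \<rho>"
  shows "J_lim \<sigma> \<rho> \<le> liminf (\<lambda>n. J_lim \<sigma> (\<rho>s n))"
proof (rule J_lim_le_liminf[OF assms])
  fix s :: real assume "0 < s"
  then show "\<forall>\<^sub>F n in sequentially. ereal (J_trunc \<sigma> s (\<rho>s n)) \<le> J_lim \<sigma> (\<rho>s n)"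
    by (intro always_eventually allI J_trunc_le_J_lim assms)
qed

text \<open>For fixed \<open>s\<close> the radii \<open>r n\<close> are eventually below
  \<open>s\<close>, and from then on monotonicity bounds the functional at \<open>r n\<close> from
  below by the one at \<open>s\<close>.\<close>

lemma J_lim_liminf_inequality:
  fixes \<rho> :: "'a::euclidean_space \<Rightarrow> real"
  assumes "- real DIM('a) < \<sigma>" "\<And>n. \<rho>s n \<in> L1_unit" "\<rho> \<in> L1_unit" "L1_tendsto \<rho>s \<rho>"
    and r: "\<And>n. 0 < r n" "r \<longlonglongrightarrow> 0"
  shows "J_lim \<sigma> \<rho> \<le> liminf (\<lambda>n. ereal (J_trunc \<sigma> (r n) (\<rho>s n)))"
proof (rule J_lim_le_liminf[OF assms(1-4)])
  fix s :: real assume "0 < s"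
  with r(2) have "\<forall>\<^sub>F n in sequentially. r n < s"
    by (rule order_tendstoD(2))
  then show "\<forall>\<^sub>F n in sequentially. ereal (J_trunc \<sigma> s (\<rho>s n)) \<le> ereal (J_trunc \<sigma> (r n) (\<rho>s n))"
    by eventually_elim (use assms r in \<open>auto intro!: J_trunc_antimono\<close>)
qed

text \<open>The limsup inequality for the constant recovery sequence: every truncation lies below
  the supremum.\<close>

lemma J_trunc_limsup_le_J_lim:
  fixes \<rho> :: "'a::euclidean_space \<Rightarrow> real"
  assumes "- real DIM('a) < \<sigma>" "\<rho> \<in> L1_unit" "\<And>n. 0 < r n"
  shows "limsup (\<lambda>n. ereal (J_trunc \<sigma> (r n) \<rho>)) \<le> J_lim \<sigma> \<rho>"
  by (intro Limsup_bounded always_eventually allI J_trunc_le_J_lim assms)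

text \<open>Lets the statements about densities be applied to sets of finite measure.\<close>

lemma indicator_in_L1_unit: "E \<in> lmeasurable \<Longrightarrow> indicat_real E \<in> L1_unit"
  by (auto simp: L1_unit_def lmeasurable_iff_integrable indicator_def)

theorem proposition3p5:
  fixes \<sigma> :: real
  assumes "- real DIM('a::euclidean_space) < \<sigma>" and "\<sigma> < 1"
  shows
    "(\<forall>r>0. \<forall>\<rho>\<in>L1_unit. \<forall>\<rho>s :: nat \<Rightarrow> 'a \<Rightarrow> real.
        (\<forall>n. \<rho>s n \<in> L1_unit) \<and> L1_tendsto \<rho>s \<rho> \<longrightarrow>
          (\<lambda>n. J_trunc \<sigma> r (\<rho>s n)) \<longlonglongrightarrow> J_trunc \<sigma> r \<rho>)
     \<and> (\<forall>\<rho>\<in>L1_unit :: ('a \<Rightarrow> real) set.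
          antimono_on {0<..} (\<lambda>r. J_trunc \<sigma> r \<rho>) \<and>
          ((\<lambda>r. ereal (J_trunc \<sigma> r \<rho>)) \<longlongrightarrow> J_lim \<sigma> \<rho>) (at_right 0) \<and>
          J_lim \<sigma> \<rho> \<noteq> - \<infinity>)
     \<and> (\<forall>\<rho>\<in>L1_unit. \<forall>\<rho>s :: nat \<Rightarrow> 'a \<Rightarrow> real.
          (\<forall>n. \<rho>s n \<in> L1_unit) \<and> L1_tendsto \<rho>s \<rho> \<longrightarrow>
            J_lim \<sigma> \<rho> \<le> liminf (\<lambda>n. J_lim \<sigma> (\<rho>s n)))
     \<and> Gamma_limit_at_0 (L1_unit :: ('a \<Rightarrow> real) set) L1_tendsto
          (\<lambda>r \<rho>. ereal (J_trunc \<sigma> r \<rho>)) (J_lim \<sigma>)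
     \<and> Gamma_limit_at_0 (lmeasurable :: 'a set set)
          (\<lambda>Es E. L1_tendsto (\<lambda>n. indicat_real (Es n)) (indicat_real E))
          (\<lambda>r E. ereal (J_trunc \<sigma> r (indicat_real E))) (\<lambda>E. J_lim \<sigma> (indicat_real E))"
proof (intro conjI)
  note \<sigma> = assms(1)
  have const: "L1_tendsto (\<lambda>n. \<rho>) \<rho>" for \<rho> :: "'a \<Rightarrow> real"
    by (simp add: L1_tendsto_def)
  show "\<forall>r>0. \<forall>\<rho>\<in>L1_unit. \<forall>\<rho>s :: nat \<Rightarrow> 'a \<Rightarrow> real.
        (\<forall>n. \<rho>s n \<in> L1_unit) \<and> L1_tendsto \<rho>s \<rho> \<longrightarrow>
          (\<lambda>n. J_trunc \<sigma> r (\<rho>s n)) \<longlonglongrightarrow> J_trunc \<sigma> r \<rho>"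
    using J_trunc_continuous[OF _ \<sigma>] by (auto simp: L1_unit_def)
  show "\<forall>\<rho>\<in>L1_unit :: ('a \<Rightarrow> real) set.
          antimono_on {0<..} (\<lambda>r. J_trunc \<sigma> r \<rho>) \<and>
          ((\<lambda>r. ereal (J_trunc \<sigma> r \<rho>)) \<longlongrightarrow> J_lim \<sigma> \<rho>) (at_right 0) \<and>
          J_lim \<sigma> \<rho> \<noteq> - \<infinity>"
  proof (intro ballI conjI)
    fix \<rho> :: "'a \<Rightarrow> real" assume \<rho>: "\<rho> \<in> L1_unit"
    show "antimono_on {0<..} (\<lambda>r. J_trunc \<sigma> r \<rho>)"
      using \<sigma> \<rho> by (auto intro!: monotone_onI J_trunc_antimono)
    show "((\<lambda>r. ereal (J_trunc \<sigma> r \<rho>)) \<longlongrightarrow> J_lim \<sigma> \<rho>) (at_right 0)"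
      by (rule J_lim_tendsto(1)[OF \<sigma> \<rho>])
    \<comment> \<open>Any positive radius would serve: a real-valued truncation is a lower bound for
      the limit and rules out \<open>- \<infinity>\<close>.\<close>
    have "ereal (J_trunc \<sigma> 1 \<rho>) \<le> J_lim \<sigma> \<rho>"
      by (intro J_trunc_le_J_lim \<sigma> \<rho>) simp
    then show "J_lim \<sigma> \<rho> \<noteq> - \<infinity>"
      by auto
  qed
  show "\<forall>\<rho>\<in>L1_unit. \<forall>\<rho>s :: nat \<Rightarrow> 'a \<Rightarrow> real.
          (\<forall>n. \<rho>s n \<in> L1_unit) \<and> L1_tendsto \<rho>s \<rho> \<longrightarrow>
            J_lim \<sigma> \<rho> \<le> liminf (\<lambda>n. J_lim \<sigma> (\<rho>s n))"
    using J_lim_lower_semicontinuous[OF \<sigma>] by blast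
  show "Gamma_limit_at_0 (L1_unit :: ('a \<Rightarrow> real) set) L1_tendsto
          (\<lambda>r \<rho>. ereal (J_trunc \<sigma> r \<rho>)) (J_lim \<sigma>)"
    unfolding Gamma_limit_at_0_def
  proof (intro allI impI conjI ballI)
    fix r :: "nat \<Rightarrow> real" and \<rho> :: "'a \<Rightarrow> real" and \<rho>s
    assume "(\<forall>n. 0 < r n) \<and> r \<longlonglongrightarrow> 0" "\<rho> \<in> L1_unit" "(\<forall>n. \<rho>s n \<in> L1_unit) \<and> L1_tendsto \<rho>s \<rho>"
    then show "J_lim \<sigma> \<rho> \<le> liminf (\<lambda>n. ereal (J_trunc \<sigma> (r n) (\<rho>s n)))"
      by (intro J_lim_liminf_inequality \<sigma>) auto
  next
    fix r :: "nat \<Rightarrow> real" and \<rho> :: "'a \<Rightarrow> real"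
    assume "(\<forall>n. 0 < r n) \<and> r \<longlonglongrightarrow> 0" "\<rho> \<in> L1_unit"
    then show "\<exists>\<rho>s. (\<forall>n. \<rho>s n \<in> L1_unit) \<and> L1_tendsto \<rho>s \<rho> \<and>
        limsup (\<lambda>n. ereal (J_trunc \<sigma> (r n) (\<rho>s n))) \<le> J_lim \<sigma> \<rho>"
      using \<sigma> const by (intro exI[of _ "\<lambda>n. \<rho>"]) (auto intro!: J_trunc_limsup_le_J_lim)
  qed
  show "Gamma_limit_at_0 (lmeasurable :: 'a set set)
          (\<lambda>Es E. L1_tendsto (\<lambda>n. indicat_real (Es n)) (indicat_real E))
          (\<lambda>r E. ereal (J_trunc \<sigma> r (indicat_real E))) (\<lambda>E. J_lim \<sigma> (indicat_real E))"
    unfolding Gamma_limit_at_0_def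
  proof (intro allI impI conjI ballI)
    fix r :: "nat \<Rightarrow> real" and E :: "'a set" and Es
    assume "(\<forall>n. 0 < r n) \<and> r \<longlonglongrightarrow> 0" "E \<in> lmeasurable"
      "(\<forall>n. Es n \<in> lmeasurable) \<and> L1_tendsto (\<lambda>n. indicat_real (Es n)) (indicat_real E)"
    then show "J_lim \<sigma> (indicat_real E) \<le> liminf (\<lambda>n. ereal (J_trunc \<sigma> (r n) (indicat_real (Es n))))"
      by (intro J_lim_liminf_inequality \<sigma> indicator_in_L1_unit) auto
  next
    fix r :: "nat \<Rightarrow> real" and E :: "'a set"
    assume "(\<forall>n. 0 < r n) \<and> r \<longlonglongrightarrow> 0" "E \<in> lmeasurable"
    then show "\<exists>Es. (\<forall>n. Es n \<in> lmeasurable) \<and> L1_tendsto (\<lambda>n. indicat_real (Es n)) (indicat_real E) \<and>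
        limsup (\<lambda>n. ereal (J_trunc \<sigma> (r n) (indicat_real (Es n)))) \<le> J_lim \<sigma> (indicat_real E)"
      \<comment> \<open>The constant sequence \<open>E\<close> consists of sets, so restricting the
        class does not disturb the recovery sequence.\<close>
      using \<sigma> const
      by (intro exI[of _ "\<lambda>n. E"]) (auto intro!: J_trunc_limsup_le_J_lim indicator_in_L1_unit)
  qed
qed

end
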